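(* For every positive integer $v \geq 4$, there exists a quantum Latin square of order $v$ with maximal cardinality, i.e. with cardinality $v^2$.
   Context: A quantum Latin square of order $v$, QLS$(v)$, is a $v\times v$ array $\Phi=(|\Phi_{i,j}\rangle)$ whose entries are unit column vectors of $\mathbb{C}^v$ such that the entries of every row form an orthonormal basis of $\mathbb{C}^v$ and the entries of every column form an orthonormal basis of $\mathbb{C}^v$. Two unit vectors $|u\rangle,|w\rangle\in\mathbb{C}^v$ have the same global phase if $|u\rangle=e^{\mathrm{i}\theta}|w\rangle$ for some $\theta\in[0,2\pi)$; otherwise they are distinct (up to a global phase). The cardinality $c$ of a QLS$(v)$ is the number of its entries that are distinct up to a global phase, i.e. the number of classes of its $v^2$ entries under the relation "same global phase". It satisfies $v\le c\le v^2$, and maximal cardinality means $c=v^2$. *)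

theory Defs
  imports Complex_Main "Jordan_Normal_Form.VS_Connect"
begin

text \<open>
  The space of column vectors of length \<open>v\<close> over the complex numbers is \<open>carrier_vec v\<close>, with the
  Hermitian inner product \<open>x \<bullet>c y\<close>, which is conjugate-linear in its second argument.
\<close>

definition orthonormal_basis :: "nat \<Rightarrow> (nat \<Rightarrow> complex vec) \<Rightarrow> bool" where
  "orthonormal_basis v f \<longleftrightarrow>
     vectorspace.basis class_ring (module_vec TYPE(complex) v) (f ` {..<v}) \<and>
     (\<forall>i<v. \<forall>j<v. f i \<bullet>c f j = (if i = j then 1 else 0))"

definition quantum_latin_square :: "nat \<Rightarrow> complex vec mat \<Rightarrow> bool" where
  "quantum_latin_square v \<Phi> \<longleftrightarrow>
     \<Phi> \<in> carrier_mat v v \<and>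
     (\<forall>i<v. \<forall>j<v. \<Phi> $$ (i, j) \<in> carrier_vec v \<and> \<Phi> $$ (i, j) \<bullet>c \<Phi> $$ (i, j) = 1) \<and>
     (\<forall>i<v. orthonormal_basis v (\<lambda>j. \<Phi> $$ (i, j))) \<and>
     (\<forall>j<v. orthonormal_basis v (\<lambda>i. \<Phi> $$ (i, j)))"

definition same_global_phase :: "complex vec \<Rightarrow> complex vec \<Rightarrow> bool" where
  "same_global_phase u w \<longleftrightarrow> (\<exists>\<theta>::real. 0 \<le> \<theta> \<and> \<theta> < 2 * pi \<and> u = exp (\<i> * of_real \<theta>) \<cdot>\<^sub>v w)"

definition qls_cardinality :: "complex vec mat \<Rightarrow> nat" where
  "qls_cardinality \<Phi> =
     card (elements_mat \<Phi> //
       {(u, w). u \<in> elements_mat \<Phi> \<and> w \<in> elements_mat \<Phi> \<and> same_global_phase u w})"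

end

theory Submission
  imports Defs "HOL-Combinatorics.Transposition"
begin

text \<open>
  If \<open>H\<close> and \<open>K\<close> are complex Hadamard matrices of order \<open>v\<close>, the entrywise products of the \<open>i\<close>th
  row of \<open>H\<close> with the \<open>j\<close>th row of \<open>K\<close>, divided by \<open>\<surd>v\<close>, form a quantum Latin square, because the
  unimodular common factor cancels in every inner product along a row or a column. Take for \<open>H\<close>
  the Fourier matrix and for \<open>K\<close> the Fourier matrix with columns \<open>0\<close> and \<open>1\<close> exchanged. If two
  entries agree up to a phase, then comparing the ratio of coordinates \<open>2\<close> and \<open>3\<close>, which the
  exchange leaves alone (this is where \<open>v \<ge> 4\<close> enters), shows that \<open>i + j\<close> agrees modulo \<open>v\<close> and
  that the phase is \<open>1\<close>; coordinates \<open>0\<close> and \<open>1\<close> then recover \<open>j\<close> and \<open>i\<close>.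
\<close>

text \<open>The Gram matrix of \<open>f\<close> is \<open>A * B\<close>, with \<open>f\<close> as
  rows of \<open>A\<close> and conjugates as columns of \<open>B\<close>. Being the identity, it
  forces \<open>det A\<close> to be nonzero, and \<open>v\<close> independent vectors in dimension
  \<open>v\<close> form a basis.\<close>

lemma orthonormal_basisI:
  assumes f: "\<And>i. i < v \<Longrightarrow> f i \<in> carrier_vec v"
    and orth: "\<And>i j. i < v \<Longrightarrow> j < v \<Longrightarrow> f i \<bullet>c f j = (if i = j then 1 else 0)"
  shows "orthonormal_basis v f"
proof -
  interpret vec_space "TYPE(complex)" v .
  define A where "A = mat v v (\<lambda>(i, k). f i $ k)"
  define B where "B = mat v v (\<lambda>(k, j). cnj (f j $ k))"
  have A: "A \<in> carrier_mat v v" and B: "B \<in> carrier_mat v v"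
    by (simp_all add: A_def B_def)
  have row: "row A i = f i" if "i < v" for i
    using f[OF that] that by (intro eq_vecI) (auto simp: A_def)
  have col: "col B j = conjugate (f j)" if "j < v" for j
    using f[OF that] that by (intro eq_vecI) (auto simp: B_def)
  have "A * B = 1\<^sub>m v"
  proof (rule eq_matI)
    fix i j assume "i < dim_row (1\<^sub>m v :: complex mat)" "j < dim_col (1\<^sub>m v :: complex mat)"
    then show "(A * B) $$ (i, j) = 1\<^sub>m v $$ (i, j)"
      using A B orth by (simp add: row col)
  qed (use A B in auto)
  then have "det A * det B = 1"
    using det_mult[OF A B] by simp
  then have det: "det A \<noteq> 0"
    by auto
  have inj: "inj_on f {..<v}"
    by (intro inj_onI) (metis lessThan_iff orth zero_neq_one)
  have "rows A = map f [0..<v]"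
    using A row by (auto simp: rows_def)
  then have rows: "set (rows A) = f ` {..<v}"
    by (simp add: atLeast0LessThan)
  have "lin_indpt (f ` {..<v})"
    using det_not_0_imp_lin_indpt_rows[OF A det] rows by simp
  then have "basis (f ` {..<v})"
    using f inj by (intro dim_li_is_basis) (auto simp: card_image dim_is_n)
  then show ?thesis
    using orth by (auto simp: orthonormal_basis_def)
qed

definition root_of_unity :: "nat \<Rightarrow> complex" where
  "root_of_unity v = cis (2 * pi / real v)"

lemma root_of_unity_power: "root_of_unity v ^ k = cis (2 * pi * real k / real v)"
  by (simp add: root_of_unity_def DeMoivre field_simps)

lemma root_of_unity_power_order: "v > 0 \<Longrightarrow> root_of_unity v ^ v = 1"
  by (simp add: root_of_unity_power)

lemma root_of_unity_nonzero [simp]: "root_of_unity v \<noteq> 0"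
  by (simp add: root_of_unity_def)

lemma root_of_unity_cnj [simp]: "root_of_unity v * cnj (root_of_unity v) = 1"
  by (simp add: root_of_unity_def cis_cnj cis_mult)

lemma root_of_unity_power_cnj [simp]: "root_of_unity v ^ k * cnj (root_of_unity v) ^ k = 1"
  by (metis power_mult_distrib power_one root_of_unity_cnj)

lemma root_of_unity_power_inj:
  assumes "j < v" "k < v" "root_of_unity v ^ j = root_of_unity v ^ k"
  shows "j = k"
proof -
  have "inj_on (\<lambda>k. cis (2 * pi * real k / real v)) {..<v}"
    using bij_betw_roots_unity[of v] assms(1) by (auto simp: bij_betw_def)
  then show ?thesis
    using assms by (auto simp: root_of_unity_power dest: inj_onD)
qed

lemma sum_root_of_unity:
  assumes "j < v" "k < v"
  shows "(\<Sum>m<v. root_of_unity v ^ (j * m) * cnj (root_of_unity v ^ (k * m)))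
    = (if j = k then of_nat v else 0)"
proof -
  \<comment> \<open>Since the conjugate of a root of unity is its inverse, \<open>z\<close> is the
    power with exponent \<open>j - k\<close>, and the sum is geometric with ratio
    \<open>z\<close>.\<close>
  define z where "z = root_of_unity v ^ j * cnj (root_of_unity v) ^ k"
  have z: "root_of_unity v ^ (j * m) * cnj (root_of_unity v ^ (k * m)) = z ^ m" for m
    by (simp add: z_def power_mult power_mult_distrib)
  show ?thesis
  proof (cases "j = k")
    case True
    then show ?thesis by (simp add: power_mult_distrib[symmetric])
  next
    case False
    have "z \<noteq> 1"
    proof
      assume "z = 1"
      have "root_of_unity v ^ j = z * root_of_unity v ^ k"
        by (simp add: z_def mult.assoc mult.commute[of "cnj _ ^ _"])
      then show False
        using \<open>z = 1\<close> False assms root_of_unity_power_inj by simp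
    qed
    moreover have "z ^ v = 1"
    proof -
      have "z ^ v = (root_of_unity v ^ v) ^ j * cnj (root_of_unity v ^ v) ^ k"
        by (simp add: z_def power_mult_distrib mult.commute flip: power_mult)
      then show ?thesis
        using assms by (simp add: root_of_unity_power_order)
    qed
    ultimately show ?thesis
      using False unfolding z by (simp add: geometric_sum)
  qed
qed

text \<open>Here \<open>transpose 0 1\<close> is the permutation swapping \<open>0\<close> and
  \<open>1\<close>, not a matrix transpose.\<close>

definition qls_entry :: "nat \<Rightarrow> nat \<Rightarrow> nat \<Rightarrow> complex vec" where
  "qls_entry v i j = vec v (\<lambda>m. root_of_unity v ^ (i * m) *
     root_of_unity v ^ (j * transpose 0 1 m) / of_real (sqrt (real v)))"

lemma qls_entry_carrier [simp]: "qls_entry v i j \<in> carrier_vec v"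
  by (simp add: qls_entry_def)

lemma of_real_sqrt_square: "complex_of_real (sqrt (real v)) * of_real (sqrt (real v)) = of_nat v"
  by (metis abs_of_nat of_real_mult of_real_of_nat_eq real_sqrt_mult_self)

text \<open>The grouping makes one bracket equal to 1 as soon as \<open>i = i'\<close> or
  \<open>j = j'\<close>.\<close>

lemma qls_entry_inner:
  "qls_entry v i j \<bullet>c qls_entry v i' j' =
    (\<Sum>m<v. (root_of_unity v ^ (i * m) * cnj (root_of_unity v ^ (i' * m))) *
      (root_of_unity v ^ (j * transpose 0 1 m) * cnj (root_of_unity v ^ (j' * transpose 0 1 m)))) / of_nat v"
  by (auto simp: qls_entry_def scalar_prod_def atLeast0LessThan sum_divide_distrib mult_ac
      simp flip: of_real_sqrt_square intro!: sum.cong)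

lemma qls_entry_inner_row:
  assumes "v \<ge> 2" "j < v" "j' < v"
  shows "qls_entry v i j \<bullet>c qls_entry v i j' = (if j = j' then 1 else 0)"
proof -
  \<comment> \<open>The swap only permutes the summands, so the sum reduces to the one for the
    Fourier matrix.\<close>
  have "transpose 0 1 ` {..<v} = {..<v}"
    using assms by (intro transpose_image_eq) auto
  then have "bij_betw (transpose 0 1) {..<v} {..<v}"
    by (simp add: bij_betw_def)
  then have "(\<Sum>m<v. root_of_unity v ^ (j * transpose 0 1 m) * cnj (root_of_unity v ^ (j' * transpose 0 1 m)))
      = (\<Sum>m<v. root_of_unity v ^ (j * m) * cnj (root_of_unity v ^ (j' * m)))"
    by (rule sum.reindex_bij_betw)
  then show ?thesis
    using sum_root_of_unity[OF assms(2,3)] assms(1) by (simp add: qls_entry_inner)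
qed

lemma qls_entry_inner_col:
  assumes "i < v" "i' < v"
  shows "qls_entry v i j \<bullet>c qls_entry v i' j = (if i = i' then 1 else 0)"
  using sum_root_of_unity[OF assms] assms by (simp add: qls_entry_inner)

text \<open>With \<open>c\<close> arbitrary, this covers both equality up to a phase and, for
  \<open>c = 1\<close>, plain equality.\<close>

lemma qls_entry_phase_inj:
  assumes "v \<ge> 4" "i < v" "j < v" "i' < v" "j' < v"
    and eq: "qls_entry v i j = c \<cdot>\<^sub>v qls_entry v i' j'"
  shows "i = i' \<and> j = j'"
proof -
  let ?w = "root_of_unity v"
  have *: "?w ^ (i * m) * ?w ^ (j * transpose 0 1 m)
      = c * (?w ^ (i' * m) * ?w ^ (j' * transpose 0 1 m))" if "m < v" for m
    using arg_cong[OF eq, of "\<lambda>x. x $ m"] that by (simp add: qls_entry_def)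
  define s where "s = ?w ^ i * ?w ^ j"
  define t where "t = ?w ^ i' * ?w ^ j'"
  have "s ^ 2 = c * t ^ 2" "s ^ 3 = c * t ^ 3"
    using *[of 2] *[of 3] assms(1) by (simp_all add: s_def t_def power_mult power_mult_distrib)
  \<comment> \<open>Both sides equal \<open>s ^ 3\<close>; the common factor can be cancelled
    because \<open>s\<close> and \<open>t\<close> are nonzero.\<close>
  then have "s * (c * t ^ 2) = t * (c * t ^ 2)" and c: "c \<noteq> 0"
    by (auto simp: s_def power2_eq_square power3_eq_cube)
  moreover have "t \<noteq> 0"
    by (simp add: t_def)
  ultimately have "s = t"
    by simp
  with \<open>s ^ 2 = c * t ^ 2\<close> \<open>t \<noteq> 0\<close> have "c = 1"
    by simp
  \<comment> \<open>Because of the swap, coordinate 0 involves only \<open>j\<close> and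
    \<open>j'\<close>, and coordinate 1 only \<open>i\<close> and \<open>i'\<close>.\<close>
  with *[of 0] *[of 1] assms show ?thesis
    by (auto intro: root_of_unity_power_inj)
qed

theorem theorem3p1:
  fixes v :: nat
  assumes "v \<ge> 4"
  shows "\<exists>\<Phi>. quantum_latin_square v \<Phi> \<and> qls_cardinality \<Phi> = v ^ 2"
proof (intro exI conjI)
  define \<Phi> where "\<Phi> = mat v v (\<lambda>(i, j). qls_entry v i j)"
  have \<Phi>: "\<Phi> $$ (i, j) = qls_entry v i j" if "i < v" "j < v" for i j
    using that by (simp add: \<Phi>_def)
  show "quantum_latin_square v \<Phi>"
    unfolding quantum_latin_square_def
    using assms by (auto simp: \<Phi> qls_entry_inner_row qls_entry_inner_col \<Phi>_def intro!: orthonormal_basisI)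
  let ?E = "elements_mat \<Phi>"
  let ?R = "{(u, w). u \<in> ?E \<and> w \<in> ?E \<and> same_global_phase u w}"
  have E: "?E = (\<lambda>(i, j). qls_entry v i j) ` ({..<v} \<times> {..<v})"
    by (force simp: \<Phi>_def)
  have "same_global_phase u u" for u
    unfolding same_global_phase_def by (intro exI[of _ 0]) simp
  moreover have "u = w" if "u \<in> ?E" "w \<in> ?E" "same_global_phase u w" for u w
    using that qls_entry_phase_inj[OF assms] unfolding E same_global_phase_def by auto metis
  ultimately have "?R = Id_on ?E"
    \<comment> \<open>Entries agreeing up to a phase are equal as vectors, so all classes are
      singletons and counting classes means counting entries.\<close>
    by auto
  then have "?E // ?R = (\<lambda>u. {u}) ` ?E"
    by (auto simp: quotient_def)
  then have "qls_cardinality \<Phi> = card ?E"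
    unfolding qls_cardinality_def by (simp add: card_image)
  moreover have "i = i' \<and> j = j'" if "i < v" "j < v" "i' < v" "j' < v"
    "qls_entry v i j = qls_entry v i' j'" for i j i' j'
    using qls_entry_phase_inj[of v i j i' j' 1] assms that by simp
  then have "inj_on (\<lambda>(i, j). qls_entry v i j) ({..<v} \<times> {..<v})"
    by (auto simp: inj_on_def)
  then have "card ?E = v ^ 2"
    unfolding E by (simp add: card_image card_cartesian_product power2_eq_square)
  ultimately show "qls_cardinality \<Phi> = v ^ 2"
    by simp
qed

end
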